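(* For $i,j=1,\dots,n$ let $x_{ij}\in\mathbb{C}$ be given complex numbers such that $x_{ij}=x_{ji}$ and $x_{ii}=1$. Then there exist $l_1,\dots,l_n\in \mathrm{S}\mathcal{L}$ for which $\langle l_i,l_j\rangle=x_{ij}$ (for all $i,j$) if and only if $\mathrm{rank}(X)\le 3$, where $X$ is the $n\times n$ matrix whose $(i,j)$-th entry is $x_{ij}$. If some $x_{ij}\ne\pm1$ then the arrangement of lines $l_1,\dots,l_n$ is unique up to the action of $\mathrm{PSL}_2\mathbb{C}\times\{\pm1\}$, i.e. unique up to orientation-preserving isometry and simultaneous reversal of orientations.
   Context: $\mathcal{L}$ is the complex vector space of $2\times2$ complex matrices with zero trace, with the symmetric bilinear form $\langle l,m\rangle=-\frac12\mathrm{tr}(lm)$. $\mathrm{S}\mathcal{L}=\{l\in\mathrm{SL}_2\mathbb{C}\mid \mathrm{tr}\,l=0\}=\{l\in\mathcal{L}\mid\langle l,l\rangle=1\}$ is identified with the set of oriented lines in hyperbolic 3-space $\mathbb{H}^3$: $l$ corresponds to the line with ordered end-points $(p,q)$ on $\mathbb{S}^2_\infty=\mathbb{CP}^1$, where $p$ is the eigenspace of eigenvalue $-i$ and $q$ that of eigenvalue $i$. Then $-l$ is the same line with opposite orientation, and $\langle l,m\rangle$ is $\cosh$ of the complex distance between $l$ and $m$. An element $g\in\mathrm{PSL}_2\mathbb{C}$ acts by $g\cdot l=\tilde g l\tilde g^{-1}$ ($\tilde g\in\mathrm{SL}_2\mathbb{C}$ a lift of $g$), corresponding to the action of orientation-preserving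 isometries on oriented lines, and $-1\in\{\pm1\}$ acts by $l\mapsto -l$ simultaneously on all lines. *)

theory Defs
  imports "HOL-Analysis.Analysis" "HOL-Algebra.Coset" "HOL-Algebra.Sym_Groups"
begin

definition traceless :: "(complex^2^2) set" where
  "traceless = {l. trace l = 0}"

definition l_form :: "complex^2^2 \<Rightarrow> complex^2^2 \<Rightarrow> complex"  (\<open>\<langle>_, _\<rangle>\<close>) where
  "\<langle>l, m\<rangle> = - (1/2) * trace (l ** m)"

definition SL2C :: "(complex^2^2) monoid" where
  "SL2C = \<lparr>carrier = {A. det A = 1}, mult = (**), one = mat 1\<rparr>"

text \<open>
  An element \<open>l\<close> stands for the oriented line in hyperbolic 3-space that runs from the eigenspace
  of \<open>l\<close> for the eigenvalue \<open>- \<i>\<close> to the eigenspace for the eigenvalue \<open>\<i>\<close>, regarded as points of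
  the boundary sphere \<open>CP\<^sup>1\<close>. The line with reversed orientation is \<open>- l\<close>.
\<close>

definition oriented_lines :: "(complex^2^2) set" where
  "oriented_lines = {l \<in> carrier SL2C. trace l = 0}"

definition PSL2C :: "(complex^2^2) set monoid" where
  "PSL2C = SL2C Mod {mat 1, - mat 1}"

text \<open>The choice of the lift is immaterial, see \<open>psl_act_lift\<close> below.\<close>

definition psl_act :: "(complex^2^2) set \<Rightarrow> complex^2^2 \<Rightarrow> complex^2^2" where
  "psl_act g l = (let A = (SOME A. A \<in> g) in A ** l ** matrix_inv A)"

text \<open>The library's \<open>sign_img\<close> is the multiplicative group \<open>{1, - 1}\<close> of integers.\<close>

definition line_act :: "(complex^2^2) set \<times> int \<Rightarrow> complex^2^2 \<Rightarrow> complex^2^2" where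
  "line_act = (\<lambda>(g, e) l. of_int e *\<^sub>R psl_act g l)"


lemma mat2_mult:
  fixes A B :: "complex^2^2"
  shows "(A ** B) $ i $ j = A $ i $ 1 * B $ 1 $ j + A $ i $ 2 * B $ 2 $ j"
  by (simp add: matrix_matrix_mult_def sum_2)

lemma trace_2:
  fixes A :: "complex^2^2"
  shows "trace A = A $ 1 $ 1 + A $ 2 $ 2"
  by (simp add: trace_def sum_2)

lemma l_form_commute: "\<langle>l, m\<rangle> = \<langle>m, l\<rangle>"
  by (simp add: l_form_def trace_2 mat2_mult algebra_simps)

lemma oriented_lines_eq: "oriented_lines = {l \<in> traceless. \<langle>l, l\<rangle> = 1}"
proof -
  have "det l = 1 \<longleftrightarrow> \<langle>l, l\<rangle> = 1" if "trace l = 0" for l :: "complex^2^2"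
  proof -
    have "l $ 2 $ 2 = - l $ 1 $ 1"
      using that by (simp add: trace_2 eq_neg_iff_add_eq_0 add.commute)
    then have "\<langle>l, l\<rangle> = det l"
      by (simp add: l_form_def trace_2 mat2_mult det_2 algebra_simps)
    then show ?thesis by simp
  qed
  then show ?thesis
    by (auto simp: oriented_lines_def traceless_def SL2C_def)
qed

lemma matrix_inv_unique:
  fixes A :: "complex^2^2"
  assumes "A ** B = mat 1"
  shows "matrix_inv A = B"
proof -
  have *: "B ** A = mat 1"
    using assms by (simp add: matrix_left_right_inverse)
  have "\<exists>A'. A ** A' = mat 1 \<and> A' ** A = mat 1"
    using assms * by blast
  then have "matrix_inv A ** A = mat 1"
    unfolding matrix_inv_def by (rule someI2_ex) auto
  then show ?thesis
    by (metis assms matrix_mul_assoc matrix_mul_lid matrix_mul_rid)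
qed

lemma det_inv_right:
  fixes A :: "complex^2^2"
  assumes "det A = 1"
  shows "A ** matrix_inv A = mat 1" "matrix_inv A ** A = mat 1"
proof -
  obtain B where B: "A ** B = mat 1"
    using assms invertible_det_nz[of A] by (auto simp: invertible_def)
  then show "A ** matrix_inv A = mat 1"
    using matrix_inv_unique by simp
  then show "matrix_inv A ** A = mat 1"
    by (simp add: matrix_left_right_inverse)
qed

lemma group_SL2C: "group SL2C"
proof (rule groupI)
  fix A assume "A \<in> carrier SL2C"
  then have d: "det A = 1" by (simp add: SL2C_def)
  have "det (matrix_inv A) = 1"
    using arg_cong[OF det_inv_right(1)[OF d], of det] d by (simp add: det_mul)
  then show "\<exists>B\<in>carrier SL2C. B \<otimes>\<^bsub>SL2C\<^esub> A = \<one>\<^bsub>SL2C\<^esub>"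
    using det_inv_right(2)[OF d] by (auto simp: SL2C_def)
qed (auto simp: SL2C_def det_mul matrix_mul_assoc)

lemma neg_mat_mult [simp]:
  fixes A B :: "complex^2^2"
  shows "(- A) ** B = - (A ** B)" "A ** (- B) = - (A ** B)"
  by (simp_all add: vec_eq_iff mat2_mult)

lemma det_neg_2 [simp]:
  fixes A :: "complex^2^2"
  shows "det (- A) = det A"
  by (simp add: det_2)

lemma normal_center_SL2C: "{mat 1, - mat 1} \<lhd> SL2C"
proof -
  have sub: "subgroup {mat 1, - mat 1} SL2C"
  proof (rule group.subgroupI[OF group_SL2C])
    fix A :: "complex^2^2" assume A: "A \<in> {mat 1, - mat 1}"
    have "inv\<^bsub>SL2C\<^esub> A = A"
      by (rule group.inv_equality[OF group_SL2C])
        (use A in \<open>auto simp: SL2C_def\<close>)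
    then show "inv\<^bsub>SL2C\<^esub> A \<in> {mat 1, - mat 1}"
      using A by simp
  qed (auto simp: SL2C_def)
  show ?thesis
    by (rule group.normalI[OF group_SL2C sub])
      (auto simp: r_coset_def l_coset_def SL2C_def)
qed

lemma group_PSL2C: "group PSL2C"
  unfolding PSL2C_def by (rule normal.factorgroup_is_group[OF normal_center_SL2C])

lemma carrier_PSL2C: "carrier PSL2C = {{A, - A} | A. det A = 1}"
  by (auto simp: PSL2C_def FactGroup_def RCOSETS_def r_coset_def SL2C_def)

lemma psl_act_lift:
  assumes "g \<in> carrier PSL2C" "A \<in> g"
  shows "psl_act g l = A ** l ** matrix_inv A"
proof -
  obtain C where C: "g = {C, - C}" "det C = 1"
    using assms(1) by (auto simp: carrier_PSL2C)
  have "matrix_inv (- C) = - matrix_inv C"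
    by (rule matrix_inv_unique) (simp add: det_inv_right(1)[OF C(2)])
  then have *: "B ** l ** matrix_inv B = C ** l ** matrix_inv C" if "B \<in> g" for B
    using that C(1) by auto
  have "(SOME B. B \<in> g) \<in> g"
    using assms(2) by (rule someI)
  then show ?thesis
    using * assms(2) by (simp add: psl_act_def)
qed

end

theory Submission
  imports Defs
begin

text \<open>
  The traceless matrices form a three-dimensional space with nondegenerate form, so Gram matrices
  have rank at most 3; conversely, a complex symmetric matrix of rank at most 3 is a sum of three
  terms \<open>f\<^sub>t(i) f\<^sub>t(j)\<close>, obtained by splitting off one anisotropic vector at a time, and these
  \<open>f\<^sub>t(i)\<close> serve as coordinates of lines in an orthonormal basis.

  For uniqueness, a pair of lines with \<open>x\<^sub>i\<^sub>j \<noteq> \<plusminus>1\<close> is conjugate to a normal form depending only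
  on \<open>x\<^sub>i\<^sub>j\<close>. Once both arrangements contain this normal pair, every other line is determined by
  the Gram matrix up to its component along the common normal of the pair, and these components
  agree up to one common sign. A half-turn combined with reversal of all orientations is the
  reflection that fixes the pair and changes that sign.
\<close>

section \<open>Symmetric matrices of bounded rank\<close>

text \<open>A nonzero diagonal entry makes a basis vector work. If the diagonal vanishes,
  polarization helps: the form takes the value \<open>2 * X $ i $ j\<close> at the sum of two basis
  vectors.\<close>

lemma symmetric_anisotropic_vector:
  fixes X :: "complex^'n^'n"
  assumes sym: "\<And>i j. X $ i $ j = X $ j $ i" and "X \<noteq> 0"
  obtains v where "(\<Sum>i\<in>UNIV. v $ i * (X *v v) $ i) \<noteq> 0"
proof (cases "\<exists>i. X $ i $ i \<noteq> 0")
  case True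
  then obtain i where "X $ i $ i \<noteq> 0" by blast
  moreover have "(\<Sum>k\<in>UNIV. axis i 1 $ k * (X *v axis i 1) $ k) = X $ i $ i"
    by (simp add: matrix_vector_mult_def axis_def mult_delta_left mult_delta_right)
  ultimately have "(\<Sum>k\<in>UNIV. axis i 1 $ k * (X *v axis i 1) $ k) \<noteq> 0"
    by simp
  then show ?thesis by (rule that)
next
  case False
  obtain i j where ij: "X $ i $ j \<noteq> 0"
    using assms(2) by (auto simp: vec_eq_iff)
  let ?v = "axis i 1 + axis j 1 :: complex^'n"
  have "(\<Sum>k\<in>UNIV. ?v $ k * (X *v ?v) $ k) = 2 * X $ i $ j"
    using False sym[of j i]
    by (simp add: matrix_vector_mult_def axis_def distrib_left distrib_right sum.distrib
        mult_delta_left mult_delta_right)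
  with ij show ?thesis
    by (intro that[of ?v]) (simp only: mult_eq_0_iff, simp)
qed

text \<open>Induction on \<open>k\<close>: for \<open>w = X *v v\<close> and \<open>d\<close> the
  nonzero value of the form at \<open>v\<close>, subtracting \<open>w $ i * w $ j / d\<close> keeps
  symmetry and lowers the rank. Complex square roots absorb \<open>d\<close>, so no signs
  appear.\<close>

lemma symmetric_sum_of_squares:
  fixes X :: "complex^'n^'n"
  assumes "\<And>i j. X $ i $ j = X $ j $ i" "rank X \<le> k"
  shows "\<exists>f. \<forall>i j. X $ i $ j = (\<Sum>t<k. f t i * f t j)"
  using assms
proof (induction k arbitrary: X)
  case (0 X)
  then have "rows X \<subseteq> {0}"
    by (simp add: row_rank_def_gen)
  then have "X = 0"
    by (fastforce simp: rows_def row_def vec_eq_iff)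
  then show ?case by simp
next
  case (Suc k X)
  show ?case
  proof (cases "X = 0")
    case True
    then show ?thesis by (intro exI[of _ "\<lambda>_ _. 0"]) simp
  next
    case False
    then obtain v where v: "(\<Sum>i\<in>UNIV. v $ i * (X *v v) $ i) \<noteq> 0"
      using symmetric_anisotropic_vector Suc.prems(1) by blast
    define w where "w = X *v v"
    define d where "d = (\<Sum>i\<in>UNIV. v $ i * w $ i)"
    have d: "d \<noteq> 0" using v by (simp add: d_def w_def)
    define Y where "Y = (\<chi> i j. X $ i $ j - w $ i * w $ j / d)"
    have w_row: "w = (\<Sum>i\<in>UNIV. v $ i *s row i X)"
      using Suc.prems(1)
      by (simp add: vec_eq_iff w_def matrix_vector_mult_def row_def mult.commute)
    have w_in: "w \<in> vec.span (rows X)"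
      unfolding w_row by (intro vec.span_sum vec.span_scale vec.span_base) (auto simp: rows_def)
    \<comment> \<open>The rank drops because the rows of \<open>Y\<close> lie both in the row space
      of \<open>X\<close> and in the hyperplane \<open>?K\<close>, whereas \<open>w\<close> lies in
      the former but pairs with \<open>v\<close> to \<open>d\<close>, which is nonzero.\<close>
    let ?K = "{u. (\<Sum>j\<in>UNIV. v $ j * u $ j) = 0}"
    have K: "vec.subspace ?K"
      by (rule vec.subspaceI)
        (auto simp: distrib_left sum.distrib mult.left_commute simp flip: sum_distrib_left)
    have rowY: "row i Y = row i X - (w $ i / d) *s w" for i
      by (simp add: vec_eq_iff row_def Y_def)
    have "row i Y \<in> ?K" for i
    proof -
      have "(\<Sum>j\<in>UNIV. v $ j * row i Y $ j)
          = (\<Sum>j\<in>UNIV. X $ i $ j * v $ j) - w $ i / d * (\<Sum>j\<in>UNIV. v $ j * w $ j)"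
        by (simp add: row_def Y_def sum_distrib_left algebra_simps sum_subtractf)
      also have "\<dots> = 0"
        using d by (simp add: w_def[THEN arg_cong[of _ _ "\<lambda>u. u $ i"]] matrix_vector_mult_def
            flip: d_def)
      finally show ?thesis by simp
    qed
    then have spanK: "vec.span (rows Y) \<subseteq> ?K"
      using vec.span_minimal[OF _ K, of "rows Y"] by (auto simp: rows_def)
    have "row i Y \<in> vec.span (rows X)" for i
      unfolding rowY
      by (intro vec.span_diff vec.span_scale w_in vec.span_base) (auto simp: rows_def)
    then have "vec.span (rows Y) \<subseteq> vec.span (rows X)"
      by (intro vec.span_minimal) (auto simp: rows_def)
    moreover have "w \<notin> vec.span (rows Y)"
      using spanK d by (auto simp: d_def)
    ultimately have "vec.span (rows Y) \<subset> vec.span (rows X)"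
      using w_in by blast
    then have "vec.dim (rows Y) < vec.dim (rows X)"
      by (rule vec.dim_psubset)
    then have "rank Y \<le> k"
      using Suc.prems(2) by (simp add: row_rank_def_gen)
    moreover have "Y $ i $ j = Y $ j $ i" for i j
      using Suc.prems(1)[of i j] by (simp add: Y_def mult.commute)
    ultimately obtain f where f: "\<And>i j. Y $ i $ j = (\<Sum>t<k. f t i * f t j)"
      using Suc.IH by blast
    \<comment> \<open>The term split off becomes the square with index \<open>k\<close>;
      \<open>csqrt d\<close> shares \<open>d\<close> evenly between its two factors.\<close>
    let ?g = "\<lambda>t i. if t = k then w $ i / csqrt d else f t i"
    have "X $ i $ j = (\<Sum>t<Suc k. ?g t i * ?g t j)" for i j
    proof -
      have "X $ i $ j = Y $ i $ j + w $ i * w $ j / d"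
        by (simp add: Y_def)
      also have "w $ i * w $ j / d = (w $ i / csqrt d) * (w $ j / csqrt d)"
        by (simp flip: power2_eq_square)
      finally show ?thesis by (simp add: f)
    qed
    then show ?thesis by (intro exI[of _ ?g]) blast
  qed
qed

section \<open>Coordinates on the space of traceless matrices\<close>

definition mat22 :: "'a \<Rightarrow> 'a \<Rightarrow> 'a \<Rightarrow> 'a \<Rightarrow> 'a::zero^2^2" where
  "mat22 a b c d = vector [vector [a, b], vector [c, d]]"

lemma mat22_nth [simp]:
  "mat22 a b c d $ 1 $ 1 = a" "mat22 a b c d $ 1 $ 2 = b"
  "mat22 a b c d $ 2 $ 1 = c" "mat22 a b c d $ 2 $ 2 = d"
  by (simp_all add: mat22_def)

lemma mat2_eq_iff:
  "A = B \<longleftrightarrow> A $ 1 $ 1 = B $ 1 $ 1 \<and> A $ 1 $ 2 = B $ 1 $ 2 \<and>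
             A $ 2 $ 1 = B $ 2 $ 1 \<and> A $ 2 $ 2 = B $ 2 $ 2"
  for A B :: "'a^2^2"
  by (auto simp: vec_eq_iff forall_2)

text \<open>Trace zero eliminates the entry at \<open>(2, 2)\<close>. The three remaining
  coordinates are the source of the rank bound 3.\<close>

lemma l_form_coords:
  assumes "l \<in> traceless" "m \<in> traceless"
  shows "\<langle>l, m\<rangle> = - l $ 1 $ 1 * m $ 1 $ 1
           - (l $ 1 $ 2 * m $ 2 $ 1 + l $ 2 $ 1 * m $ 1 $ 2) / 2"
proof -
  have "l $ 2 $ 2 = - l $ 1 $ 1" "m $ 2 $ 2 = - m $ 1 $ 1"
    using assms by (simp_all add: traceless_def trace_2 eq_neg_iff_add_eq_0 add.commute)
  then show ?thesis
    by (simp add: l_form_def trace_2 mat2_mult field_simps)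
qed

section \<open>Gram matrices of traceless matrices\<close>

lemma rank_gram_le_3:
  fixes l :: "'n::finite \<Rightarrow> complex^2^2"
  assumes "\<And>i. l i \<in> traceless"
  shows "rank (\<chi> i j. \<langle>l i, l j\<rangle>) \<le> 3"
proof -
  let ?X = "\<chi> i j. \<langle>l i, l j\<rangle>"
  let ?u = "\<chi> j. l j $ 1 $ 1" and ?v = "\<chi> j. l j $ 1 $ 2" and ?w = "\<chi> j. l j $ 2 $ 1"
  have "row i ?X \<in> vec.span {?u, ?v, ?w}" for i
  proof -
    have "row i ?X = (- l i $ 1 $ 1) *s ?u + (- l i $ 2 $ 1 / 2) *s ?v + (- l i $ 1 $ 2 / 2) *s ?w"
      by (simp add: vec_eq_iff row_def l_form_coords assms field_simps)
    also have "\<dots> \<in> vec.span {?u, ?v, ?w}"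
      by (intro vec.span_add vec.span_scale vec.span_base) auto
    finally show ?thesis .
  qed
  then have "vec.dim (rows ?X) \<le> card {?u, ?v, ?w}"
    by (intro vec.dim_le_card) (auto simp: rows_def)
  also have "\<dots> \<le> 3"
    by (simp add: card_insert_if)
  finally show ?thesis by (simp add: row_rank_def_gen)
qed

lemma gram_realization:
  fixes x :: "'n::finite \<Rightarrow> 'n \<Rightarrow> complex"
  assumes sym: "\<And>i j. x i j = x j i" and "rank (\<chi> i j. x i j) \<le> 3"
  shows "\<exists>l. (\<forall>i. l i \<in> traceless) \<and> (\<forall>i j. \<langle>l i, l j\<rangle> = x i j)"
proof -
  have "\<exists>f. \<forall>i j. (\<chi> i j. x i j) $ i $ j = (\<Sum>t<3::nat. f t i * f t j)"
    by (rule symmetric_sum_of_squares) (simp, rule sym, rule assms(2))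
  then obtain f where "\<forall>i j. x i j = (\<Sum>t<3::nat. f t i * f t j)"
    by auto
  then have f: "x i j = f 0 i * f 0 j + f 1 i * f 1 j + f 2 i * f 2 j" for i j
    by (simp add: eval_nat_numeral)
  \<comment> \<open>The \<open>f t i\<close> are coordinates in the orthonormal basis
    \<open>mat22 \<i> 0 0 (- \<i>)\<close>, \<open>mat22 0 1 (- 1) 0\<close>,
    \<open>mat22 0 \<i> \<i> 0\<close>.\<close>
  define l where
    "l i = mat22 (\<i> * f 0 i) (f 1 i + \<i> * f 2 i) (- f 1 i + \<i> * f 2 i) (- \<i> * f 0 i)" for i
  have T: "l i \<in> traceless" for i
    by (simp add: l_def traceless_def trace_2)
  moreover have "\<langle>l i, l j\<rangle> = x i j" for i j
    unfolding l_form_coords[OF T T] by (simp add: l_def f field_simps)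
  ultimately show ?thesis by blast
qed

section \<open>Conjugation in \<open>SL\<^sub>2(\<complex>)\<close>\<close>

lemma det_matrix_inv:
  fixes A :: "complex^2^2"
  assumes "det A = 1"
  shows "det (matrix_inv A) = 1"
  using arg_cong[OF det_inv_right(1)[OF assms], of det] assms by (simp add: det_mul)

lemma trace_conj:
  fixes A :: "complex^2^2"
  assumes "det A = 1"
  shows "trace (A ** l ** matrix_inv A) = trace l"
proof -
  have "trace (A ** l ** matrix_inv A) = trace (l ** matrix_inv A ** A)"
    by (simp add: trace_mul_sym[of A] flip: matrix_mul_assoc)
  also have "\<dots> = trace l"
    by (simp add: det_inv_right(2)[OF assms] flip: matrix_mul_assoc)
  finally show ?thesis .
qed

lemma conj_eq_iff:
  fixes A :: "complex^2^2"
  assumes "det A = 1"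
  shows "A ** l ** matrix_inv A = m \<longleftrightarrow> A ** l = m ** A"
proof
  assume "A ** l ** matrix_inv A = m"
  then have "m ** A = A ** l ** (matrix_inv A ** A)"
    by (simp add: matrix_mul_assoc)
  then show "A ** l = m ** A"
    by (simp add: det_inv_right[OF assms])
next
  assume "A ** l = m ** A"
  then have "A ** l ** matrix_inv A = m ** (A ** matrix_inv A)"
    by (simp add: matrix_mul_assoc)
  then show "A ** l ** matrix_inv A = m"
    by (simp add: det_inv_right[OF assms])
qed

lemma l_form_conj:
  assumes "det A = 1"
  shows "\<langle>A ** l ** matrix_inv A, A ** m ** matrix_inv A\<rangle> = \<langle>l, m\<rangle>"
proof -
  have "(A ** l ** matrix_inv A) ** (A ** m ** matrix_inv A) = A ** (l ** m) ** matrix_inv A"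
  proof -
    have "(A ** l ** matrix_inv A) ** (A ** m ** matrix_inv A)
        = A ** l ** (matrix_inv A ** A) ** m ** matrix_inv A"
      by (simp add: matrix_mul_assoc)
    then show ?thesis
      by (simp add: det_inv_right[OF assms] matrix_mul_assoc)
  qed
  then show ?thesis by (simp add: l_form_def trace_conj assms)
qed

lemma oriented_lines_conj:
  assumes "det A = 1" "l \<in> oriented_lines"
  shows "A ** l ** matrix_inv A \<in> oriented_lines"
  using assms by (simp add: oriented_lines_eq traceless_def l_form_conj trace_conj)

text \<open>A scalar factor cancels in \<open>A ** l = m ** A\<close>, so a conjugating matrix may
  be sought with any nonzero determinant and checked without inverses.\<close>

lemma SL2_rescale:
  fixes A :: "complex^2^2"
  assumes "det A \<noteq> 0"
  obtains B where "det B = 1" "\<And>l m. A ** l = m ** A \<Longrightarrow> B ** l ** matrix_inv B = m"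
proof
  let ?c = "inverse (csqrt (det A))"
  let ?B = "mat ?c ** A"
  have "det (mat c :: complex^2^2) = c\<^sup>2" for c
    by (simp add: det_2 mat_def power2_eq_square)
  then have "det ?B = ?c\<^sup>2 * det A"
    by (simp only: det_mul)
  also have "\<dots> = 1"
    using assms by (simp add: power_inverse)
  finally show d: "det ?B = 1" .
  fix l m assume lm: "A ** l = m ** A"
  have "?B ** l = mat ?c ** (m ** A)"
    by (simp add: lm flip: matrix_mul_assoc)
  also have "mat ?c ** (m ** A) = m ** ?B"
    by (simp add: mat2_eq_iff mat2_mult mat_def algebra_simps)
  finally show "?B ** l ** matrix_inv ?B = m"
    by (rule conj_eq_iff[OF d, THEN iffD2])
qed

section \<open>Normal forms of lines and of pairs of lines\<close>

definition line_std :: "complex^2^2" where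
  "line_std = mat22 \<i> 0 0 (- \<i>)"

text \<open>Pairing to \<open>x\<close> with \<open>line_std\<close> forces the diagonal, and
  determinant 1 forces the product of the other two entries; the entry 1 is a normalization.\<close>

definition line_at :: "complex \<Rightarrow> complex^2^2" where
  "line_at x = mat22 (\<i> * x) 1 (x\<^sup>2 - 1) (- \<i> * x)"

lemma oriented_lines_coords:
  assumes "l \<in> oriented_lines"
  shows "l $ 2 $ 2 = - l $ 1 $ 1" "l $ 1 $ 2 * l $ 2 $ 1 = - 1 - (l $ 1 $ 1)\<^sup>2"
proof -
  show *: "l $ 2 $ 2 = - l $ 1 $ 1"
    using assms by (simp add: oriented_lines_def trace_2 eq_neg_iff_add_eq_0 add.commute)
  have "det l = 1"
    using assms by (simp add: oriented_lines_def SL2C_def)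
  then have "l $ 1 $ 1 * (- l $ 1 $ 1) - l $ 1 $ 2 * l $ 2 $ 1 = 1"
    by (simp add: det_2 *)
  then show "l $ 1 $ 2 * l $ 2 $ 1 = - 1 - (l $ 1 $ 1)\<^sup>2"
    by algebra
qed

lemma conj_to_line_std:
  assumes "l \<in> oriented_lines"
  obtains A where "det A = 1" "A ** l ** matrix_inv A = line_std"
proof -
  define a b c where "a = l $ 1 $ 1" and "b = l $ 1 $ 2" and "c = l $ 2 $ 1"
  have d: "l $ 2 $ 2 = - a" and bc: "b * c = - 1 - a * a"
    using oriented_lines_coords[OF assms] by (simp_all add: a_def b_def c_def power2_eq_square)
  note coords = a_def[symmetric] b_def[symmetric] c_def[symmetric] d
  \<comment> \<open>The rows of the conjugating matrix are left eigenvectors of \<open>l\<close>.\<close>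
  have "\<exists>A. det A \<noteq> 0 \<and> A ** l = line_std ** A"
  proof (cases "c \<noteq> 0")
    case True
    then show ?thesis
      by (intro exI[of _ "mat22 c (\<i> - a) c (- \<i> - a)"])
        (simp add: mat2_eq_iff mat2_mult det_2 line_std_def coords bc algebra_simps)
  next
    case c: False
    show ?thesis
    proof (cases "b \<noteq> 0")
      case True
      then show ?thesis using c bc
        by (intro exI[of _ "mat22 (a + \<i>) b (a - \<i>) b"])
          (simp add: mat2_eq_iff mat2_mult det_2 line_std_def coords algebra_simps)
    next
      case b: False
      \<comment> \<open>Now \<open>l\<close> is diagonal, hence \<open>line_std\<close> or its
        reverse; swapping the coordinates undoes the reversal.\<close>
      have "(a - \<i>) * (a + \<i>) = 0"
        using bc c by (simp add: algebra_simps)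
      then consider "a = \<i>" | "a = - \<i>"
        by (auto simp: eq_neg_iff_add_eq_0)
      then show ?thesis
      proof cases
        case 1
        then show ?thesis using b c
          by (intro exI[of _ "mat22 1 0 0 1"])
            (simp add: mat2_eq_iff mat2_mult det_2 line_std_def coords)
      next
        case 2
        then show ?thesis using b c
          by (intro exI[of _ "mat22 0 1 1 0"])
            (simp add: mat2_eq_iff mat2_mult det_2 line_std_def coords)
      qed
    qed
  qed
  then show ?thesis
    by (metis SL2_rescale that)
qed

lemma conj_mult:
  fixes A B :: "complex^2^2"
  assumes "det A = 1" "det B = 1"
  shows "(B ** A) ** l ** matrix_inv (B ** A) = B ** (A ** l ** matrix_inv A) ** matrix_inv B"
proof -
  have "matrix_inv (B ** A) = matrix_inv A ** matrix_inv B"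
  proof (rule matrix_inv_unique)
    have "B ** A ** (matrix_inv A ** matrix_inv B) = B ** (A ** matrix_inv A) ** matrix_inv B"
      by (simp add: matrix_mul_assoc)
    then show "B ** A ** (matrix_inv A ** matrix_inv B) = mat 1"
      by (simp add: det_inv_right assms)
  qed
  then show ?thesis by (simp add: matrix_mul_assoc)
qed

lemma conj_inverse:
  fixes A :: "complex^2^2"
  assumes "det A = 1" "A ** l ** matrix_inv A = m"
  shows "matrix_inv A ** m ** matrix_inv (matrix_inv A) = l"
proof -
  have "A ** l = m ** A"
    using assms by (simp add: conj_eq_iff)
  then have "matrix_inv A ** m ** A = (matrix_inv A ** A) ** l"
    by (simp flip: matrix_mul_assoc)
  moreover have "matrix_inv (matrix_inv A) = A"
    by (rule matrix_inv_unique) (simp add: det_inv_right assms)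
  ultimately show ?thesis
    by (simp add: det_inv_right assms)
qed

text \<open>Once \<open>l\<close> is \<open>line_std\<close>, only a scaling of the off-diagonal
  entries of the image of \<open>m\<close> is left to fix. They are nonzero because
  \<open>x\<^sup>2 \<noteq> 1\<close>: the two lines share no end-point.\<close>

lemma conj_to_normal_pair:
  assumes l: "l \<in> oriented_lines" and m: "m \<in> oriented_lines"
    and x: "\<langle>l, m\<rangle> = x" "x\<^sup>2 \<noteq> 1"
  obtains A where "det A = 1" "A ** l ** matrix_inv A = line_std"
    "A ** m ** matrix_inv A = line_at x"
proof -
  obtain A where A: "det A = 1" "A ** l ** matrix_inv A = line_std"
    using conj_to_line_std[OF l] .
  define m' where "m' = A ** m ** matrix_inv A"
  have m': "m' \<in> oriented_lines" and std: "line_std \<in> oriented_lines"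
    using oriented_lines_conj[OF A(1)] l m by (auto simp: m'_def simp flip: A(2))
  have "\<langle>line_std, m'\<rangle> = x"
    using l_form_conj[OF A(1), of l m] x(1) by (simp add: A(2) m'_def)
  then have "- \<i> * m' $ 1 $ 1 = x"
    using m' std by (simp add: l_form_coords oriented_lines_eq) (simp add: line_std_def)
  then have a: "m' $ 1 $ 1 = \<i> * x"
    by auto
  have d: "m' $ 2 $ 2 = - \<i> * x"
    using oriented_lines_coords(1)[OF m'] a by simp
  have bc: "m' $ 1 $ 2 * m' $ 2 $ 1 = x\<^sup>2 - 1"
    using oriented_lines_coords(2)[OF m'] a by (simp add: power_mult_distrib)
  then have b: "m' $ 1 $ 2 \<noteq> 0"
    using x(2) by auto
  \<comment> \<open>Diagonal matrices commute with \<open>line_std\<close>; this one scales the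
    upper right entry of \<open>m'\<close> to 1.\<close>
  let ?C = "mat22 (1 / m' $ 1 $ 2) 0 0 1"
  have "det ?C \<noteq> 0"
    using b by (simp add: det_2)
  then obtain B where B: "det B = 1" "\<And>l m. ?C ** l = m ** ?C \<Longrightarrow> B ** l ** matrix_inv B = m"
    using SL2_rescale by blast
  have "B ** line_std ** matrix_inv B = line_std"
    by (rule B(2)) (simp add: mat2_eq_iff mat2_mult line_std_def)
  moreover have "B ** m' ** matrix_inv B = line_at x"
    by (rule B(2)) (use b in \<open>simp add: mat2_eq_iff mat2_mult line_at_def a d field_simps flip: bc\<close>)
  ultimately show ?thesis
    using A B(1) by (intro that[of "B ** A"]) (simp_all add: conj_mult det_mul m'_def)
qed

section \<open>Uniqueness\<close>

lemma normalized_uniqueness: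
  fixes l m :: "'n \<Rightarrow> complex^2^2"
  assumes l: "\<And>k. l k \<in> traceless" and m: "\<And>k. m k \<in> traceless"
    and gram: "\<And>k k'. \<langle>l k, l k'\<rangle> = \<langle>m k, m k'\<rangle>"
    and std: "l i = line_std" "m i = line_std"
    and at: "l j = line_at x" "m j = line_at x" and x: "x\<^sup>2 \<noteq> 1"
  shows "\<exists>C e. det C = 1 \<and> e \<in> {1, - 1 :: int} \<and>
    (\<forall>k. m k = of_int e *\<^sub>R (C ** l k ** matrix_inv C))"
proof -
  define y where "y = x\<^sup>2 - 1"
  have y: "y \<noteq> 0" using x by (simp add: y_def)
  have trl: "l k $ 2 $ 2 = - l k $ 1 $ 1" and trm: "m k $ 2 $ 2 = - m k $ 1 $ 1" for k
    using l[of k] m[of k]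
    by (simp_all add: traceless_def trace_2 eq_neg_iff_add_eq_0 add.commute)
  note form_l = l_form_coords[OF l l] and form_m = l_form_coords[OF m m]
  \<comment> \<open>Pairing with \<open>line_std\<close> reads off the upper left entry.\<close>
  have a: "m k $ 1 $ 1 = l k $ 1 $ 1" for k
    using gram[of i k] by (simp only: form_l form_m) (simp add: std line_std_def)
  \<comment> \<open>Given the upper left entry, pairing with \<open>line_at x\<close> reads off
    exactly this combination.\<close>
  define s where "s k = l k $ 2 $ 1 + y * l k $ 1 $ 2" for k
  have s_m: "s k = m k $ 2 $ 1 + y * m k $ 1 $ 2" for k
    using gram[of j k] a[of k] unfolding s_def
    by (simp only: form_l form_m, simp add: at line_at_def flip: y_def, algebra)
  \<comment> \<open>Modulo the span of \<open>line_std\<close> and \<open>line_at x\<close> a line is determined by its component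
    along their common normal, which is \<open>u\<close> for \<open>l\<close> and \<open>v\<close> for \<open>m\<close>.\<close>
  define t where "t k = s k / (2 * y)" for k
  define u where "u k = l k $ 1 $ 2 - t k" for k
  define v where "v k = m k $ 1 $ 2 - t k" for k
  have s: "s k = 2 * y * t k" for k
    using y by (simp add: t_def)
  have bl: "l k $ 1 $ 2 = t k + u k" and bm: "m k $ 1 $ 2 = t k + v k" for k
    by (simp_all add: u_def v_def)
  have cl: "l k $ 2 $ 1 = y * (t k - u k)" for k
    using s_def[of k] s[of k] by (simp add: u_def algebra_simps)
  have cm: "m k $ 2 $ 1 = y * (t k - v k)" for k
    using s_m[of k] s[of k] by (simp add: v_def algebra_simps)
  have uv: "u k * u k' = v k * v k'" for k k'
  proof -
    \<comment> \<open>In the new coordinates the form is diagonal, and only its last term can differ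
      between \<open>l\<close> and \<open>m\<close>.\<close>
    have *: "- p * q - ((t k + w k) * (y * (t k' - w k')) + y * (t k - w k) * (t k' + w k')) / 2
        = - p * q - y * t k * t k' + y * (w k * w k')" for p q w
      by (simp add: field_simps)
    have "y * (u k * u k') = y * (v k * v k')"
      using gram[of k k'] unfolding form_l form_m a bl bm cl cm * by simp
    then show ?thesis
      using y by simp
  qed
  \<comment> \<open>One index with \<open>u k0 \<noteq> 0\<close> fixes the sign for all others
    through the products with \<open>k0\<close>.\<close>
  have "(\<forall>k. v k = u k) \<or> (\<forall>k. v k = - u k)"
  proof (cases "\<exists>k. u k \<noteq> 0")
    case True
    then obtain k0 where k0: "u k0 \<noteq> 0" by blast
    have "v k0 = u k0 \<or> v k0 = - u k0"
      using uv[of k0 k0] by (auto simp: square_eq_iff)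
    then show ?thesis
    proof
      assume "v k0 = u k0"
      then have "v k = u k" for k
        using uv[of k0 k] k0 by simp
      then show ?thesis by blast
    next
      assume "v k0 = - u k0"
      then have "u k0 * (u k + v k) = 0" for k
        using uv[of k0 k] by (simp add: distrib_left)
      then have "v k = - u k" for k
        using k0 by (simp add: eq_neg_iff_add_eq_0 add.commute)
      then show ?thesis by blast
    qed
  next
    case False
    then have "v k = u k" for k
      using uv[of k k] by simp
    then show ?thesis by blast
  qed
  then show ?thesis
  proof
    assume "\<forall>k. v k = u k"
    then have "m k = l k" for k
      by (simp add: mat2_eq_iff trl trm a bl bm cl cm)
    moreover have "mat 1 ** l k ** matrix_inv (mat 1) = l k" for k
      by (rule conj_eq_iff[THEN iffD2]) simp_all
    ultimately show ?thesis
      by (intro exI[of _ "mat 1"] exI[of _ 1]) simp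
  next
    assume v: "\<forall>k. v k = - u k"
    \<comment> \<open>Conjugation by \<open>?R\<close> reverses \<open>line_std\<close> and \<open>line_at x\<close> and fixes their common normal.\<close>
    let ?R = "mat22 0 1 (- y) 0"
    have "det ?R \<noteq> 0"
      using y by (simp add: det_2)
    then obtain C where C: "det C = 1" "\<And>l m. ?R ** l = m ** ?R \<Longrightarrow> C ** l ** matrix_inv C = m"
      using SL2_rescale by blast
    \<comment> \<open>The half-turn negates the upper left entry and \<open>t k\<close> but keeps
      \<open>u k\<close>; this is the negative of \<open>m k\<close>, whence
      \<open>e = - 1\<close>.\<close>
    have "C ** l k ** matrix_inv C = - m k" for k
      by (rule C(2)) (use y in \<open>simp add: mat2_eq_iff mat2_mult trl trm a bl bm cl cm v field_simps\<close>)
    then show ?thesis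
      by (intro exI[of _ C] exI[of _ "- 1"]) (simp add: C(1))
  qed
qed

lemma conj_scaleR:
  fixes A B l :: "complex^2^2"
  shows "A ** (r *\<^sub>R l) ** B = r *\<^sub>R (A ** l ** B)"
  by (simp add: mat2_eq_iff mat2_mult algebra_simps)

lemma gram_uniqueness:
  fixes l m :: "'n \<Rightarrow> complex^2^2"
  assumes l: "\<And>k. l k \<in> oriented_lines" and m: "\<And>k. m k \<in> oriented_lines"
    and gram: "\<And>k k'. \<langle>l k, l k'\<rangle> = \<langle>m k, m k'\<rangle>"
    and x: "\<langle>l i, l j\<rangle> \<noteq> 1" "\<langle>l i, l j\<rangle> \<noteq> - 1"
  obtains a where "a \<in> carrier (PSL2C \<times>\<times> sign_img)" "\<And>k. m k = line_act a (l k)"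
proof -
  define x where "x = \<langle>l i, l j\<rangle>"
  have x2: "x\<^sup>2 \<noteq> 1"
    using x by (simp add: x_def power2_eq_1_iff)
  obtain A where A: "det A = 1" "A ** l i ** matrix_inv A = line_std"
      "A ** l j ** matrix_inv A = line_at x"
    using conj_to_normal_pair[OF l l _ x2] x_def by metis
  obtain B where B: "det B = 1" "B ** m i ** matrix_inv B = line_std"
      "B ** m j ** matrix_inv B = line_at x"
    using conj_to_normal_pair[OF m m _ x2] x_def gram by metis
  define l' m' where "l' = (\<lambda>k. A ** l k ** matrix_inv A)" and "m' = (\<lambda>k. B ** m k ** matrix_inv B)"
  have "l' k \<in> traceless" "m' k \<in> traceless" for k
    using oriented_lines_conj[OF A(1) l] oriented_lines_conj[OF B(1) m]
    by (simp_all add: l'_def m'_def oriented_lines_eq)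
  moreover have "\<langle>l' k, l' k'\<rangle> = \<langle>m' k, m' k'\<rangle>" for k k'
    by (simp add: l'_def m'_def l_form_conj A(1) B(1) gram)
  moreover have "l' i = line_std" "m' i = line_std" "l' j = line_at x" "m' j = line_at x"
    by (simp_all add: l'_def m'_def A B)
  ultimately obtain C e where C: "det C = 1" "e \<in> {1, - 1 :: int}"
      "\<And>k. m' k = of_int e *\<^sub>R (C ** l' k ** matrix_inv C)"
    using normalized_uniqueness[of l' m' i j x] x2 by meson
  \<comment> \<open>Both arrangements were moved to the normal pair, by \<open>A\<close> and by
    \<open>B\<close>; \<open>P\<close> goes there from \<open>l\<close>, applies \<open>C\<close>,
    and returns to \<open>m\<close>.\<close>
  define P where "P = matrix_inv B ** (C ** A)"
  have P: "det P = 1"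
    by (simp add: P_def det_mul det_matrix_inv A B C)
  have "m k = of_int e *\<^sub>R (P ** l k ** matrix_inv P)" for k
  proof -
    have "m k = matrix_inv B ** m' k ** matrix_inv (matrix_inv B)"
      by (simp add: conj_inverse[OF B(1)] m'_def)
    also have "\<dots> = of_int e *\<^sub>R (P ** l k ** matrix_inv P)"
      by (simp add: C(3) conj_scaleR P_def conj_mult det_mul det_matrix_inv A B C(1) l'_def)
    finally show ?thesis .
  qed
  moreover have g: "{P, - P} \<in> carrier PSL2C"
    using P by (auto simp: carrier_PSL2C)
  ultimately have "m k = line_act ({P, - P}, e) (l k)" for k
    by (simp add: line_act_def psl_act_lift[of _ P])
  then show ?thesis
    using g C(2) by (intro that[of "({P, - P}, e)"]) (auto simp: sign_img_def)
qed

theorem theorem7: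
  fixes x :: "'n::finite \<Rightarrow> 'n \<Rightarrow> complex"
  assumes sym: "\<And>i j. x i j = x j i"
    and diag: "\<And>i. x i i = 1"
  shows "((\<exists>l :: 'n \<Rightarrow> complex^2^2. (\<forall>i. l i \<in> oriented_lines) \<and> (\<forall>i j. \<langle>l i, l j\<rangle> = x i j))
           \<longleftrightarrow> rank (\<chi> i j. x i j) \<le> 3)
       \<and> ((\<exists>i j. x i j \<noteq> 1 \<and> x i j \<noteq> - 1) \<longrightarrow>
           (\<forall>l m :: 'n \<Rightarrow> complex^2^2.
              (\<forall>i. l i \<in> oriented_lines) \<and> (\<forall>i j. \<langle>l i, l j\<rangle> = x i j) \<and>
              (\<forall>i. m i \<in> oriented_lines) \<and> (\<forall>i j. \<langle>m i, m j\<rangle> = x i j)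
              \<longrightarrow> (\<exists>a \<in> carrier (PSL2C \<times>\<times> sign_img). \<forall>i. m i = line_act a (l i))))"
proof (intro conjI iffI impI allI)
  assume "\<exists>l :: 'n \<Rightarrow> complex^2^2. (\<forall>i. l i \<in> oriented_lines) \<and> (\<forall>i j. \<langle>l i, l j\<rangle> = x i j)"
  then obtain l :: "'n \<Rightarrow> complex^2^2"
    where l: "\<And>i. l i \<in> traceless" and x: "\<And>i j. \<langle>l i, l j\<rangle> = x i j"
    by (auto simp: oriented_lines_eq)
  show "rank (\<chi> i j. x i j) \<le> 3"
    using rank_gram_le_3[of l, OF l] by (simp add: x)
next
  assume "rank (\<chi> i j. x i j) \<le> 3"
  \<comment> \<open>The unit diagonal of \<open>x\<close> turns the traceless matrices realizing it
    into lines.\<close>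
  then show "\<exists>l. (\<forall>i. l i \<in> oriented_lines) \<and> (\<forall>i j. \<langle>l i, l j\<rangle> = x i j)"
    using gram_realization[of x, OF sym] by (auto simp: oriented_lines_eq diag)
next
  fix l m :: "'n \<Rightarrow> complex^2^2"
  assume "\<exists>i j. x i j \<noteq> 1 \<and> x i j \<noteq> - 1"
    and "(\<forall>i. l i \<in> oriented_lines) \<and> (\<forall>i j. \<langle>l i, l j\<rangle> = x i j) \<and>
      (\<forall>i. m i \<in> oriented_lines) \<and> (\<forall>i j. \<langle>m i, m j\<rangle> = x i j)"
  then show "\<exists>a \<in> carrier (PSL2C \<times>\<times> sign_img). \<forall>i. m i = line_act a (l i)"
    using gram_uniqueness[of l m] by metis
qed

end
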